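(* Let $n\ge1$ be an integer, $Q=2n+2$, $T>0$, $p,q>1$, $\beta_1,\beta_2\in[0,1)$. Let $M_1,M_2:\mathbb R_+^5\to\mathbb R$ be bounded functions such that, for some constants $C_1,C_2$ and $i=1,2$, $$0<M_i(t,\cdot,\cdot,\cdot,\cdot)\le C_it^{\beta_i}\quad\text{for all }t\in(0,\infty).$$ Put $p'=\frac p{p-1}$, $q'=\frac q{q-1}$ and $$A_1=\frac{\frac1q-\beta_1-\frac{\beta_2}q+\frac1{pq}}{\frac1{2qp'}+\frac1{2q'}},\qquad A_2=\frac{\frac1p-\beta_2-\frac{\beta_1}p+\frac1{pq}}{\frac1{2q'p}+\frac1{2p'}}.$$ If $Q<\max\{A_1,A_2\}$, then the system $$\begin{cases}u_t-M_1\left(t,\int|\nabla_{\mathbb H}u|^2dx,\int|\nabla_{\mathbb H}\omega|^2dx,\int|\Delta_{\mathbb H}u|^2dx,\int|\Delta_{\mathbb H}\omega|^2dx\right)\Delta_{\mathbb H}u=|\omega|^p,\\ \omega_t-M_2\left(t,\int|\nabla_{\mathbb H}u|^2dx,\int|\nabla_{\mathbb H}\omega|^2dx,\int|\Delta_{\mathbb H}u|^2dx,\int|\Delta_{\mathbb H}\omega|^2dx\right)\Delta_{\mathbb H}\omega=|u|^q,\\ u(x,0)=u_0(x)\ge0,\quad \omega(x,0)=\omega_0(x)\ge0,\quad x\in\mathbb H^n,\end{cases}$$ posed in $\Omega=\mathbb H^n\times(0,T)$ (inner integrals over $\mathbb H^n$), does not admit a nontrivial weak solution $(u,\omega)$.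
   Context: $\mathbb R_+=[0,\infty)$. The Heisenberg group $\mathbb H^n$ is $\mathbb R^{2n+1}$ with points $x=(\xi,\tilde\xi,\tau)$, $\xi,\tilde\xi\in\mathbb R^n$, $\tau\in\mathbb R$, equipped with the vector fields $X_i=\partial_{\xi_i}+2\tilde\xi_i\partial_\tau$, $Y_i=\partial_{\tilde\xi_i}-2\xi_i\partial_\tau$ ($i=1,\dots,n$) and with Lebesgue measure $dx$; its homogeneous dimension is $Q=2n+2$ (dilations $\delta_\lambda(x)=(\lambda\xi,\lambda\tilde\xi,\lambda^2\tau)$). The horizontal gradient is $\nabla_{\mathbb H}=(X_1,\dots,X_n,Y_1,\dots,Y_n)$ and the Kohn-Laplacian is $\Delta_{\mathbb H}=\sum_{i=1}^n(X_i^2+Y_i^2)$; both act in the variable $x$ only. $S^2_2(\mathbb H^n)=\{u: u\in L^2(\mathbb H^n),\ |\nabla_{\mathbb H}u|\in L^2(\mathbb H^n),\ |\Delta_{\mathbb H}u|\in L^2(\mathbb H^n)\}$. For a pair $(u,\omega)$ write, for $i=1,2$, $M_i[t]=M_i\left(t,\int_{\mathbb H^n}|\nabla_{\mathbb H}u|^2dx,\int_{\mathbb H^n}|\nabla_{\mathbb H}\omega|^2dx,\int_{\mathbb H^n}|\Delta_{\mathbb H}u|^2dx,\int_{\mathbb H^n}|\Delta_{\mathbb H}\omega|^2dx\right)$, where the integrals are taken at time $t$. Definition. A pair $u\in C^1(0,T;S^2_2(\mathbb H^n))\cap L^q(\Omega)$, $\omega\in C^1(0,T;S^2_2(\mathbb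 H^n))\cap L^p(\Omega)$ is a weak solution of the system on $\Omega=\mathbb H^n\times(0,T)$ with Cauchy data $(u_0,\omega_0)\in L^1_{loc}(\mathbb H^n)\times L^1_{loc}(\mathbb H^n)$, $u_0,\omega_0\ge0$ on $\mathbb H^n$, if $$\int_\Omega|\omega|^p\varphi\,dxdt+\int_{\mathbb H^n}u_0(x)\varphi(x,0)\,dx=-\int_\Omega u\varphi_t\,dxdt-\int_\Omega M_1[t]\,u\,\Delta_{\mathbb H}\varphi\,dxdt$$ and $$\int_\Omega|u|^q\psi\,dxdt+\int_{\mathbb H^n}\omega_0(x)\psi(x,0)\,dx=-\int_\Omega\omega\psi_t\,dxdt-\int_\Omega M_2[t]\,\omega\,\Delta_{\mathbb H}\psi\,dxdt$$ hold for any test functions $0\le\varphi,\psi\in C^{2,1}_{x,t}(\Omega)$ (twice continuously differentiable in $x$, once in $t$). *)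

theory Defs
  imports "HOL-Analysis.Analysis"
begin

section \<open>The Heisenberg group\<close>

text \<open>A point is \<open>(\<xi>, \<eta>, \<tau>)\<close>, where \<open>\<eta>\<close> stands for \<open>\<xi>\<close> with a tilde;
  \<open>n\<close> is \<open>CARD('n)\<close>, and the measure is \<open>lebesgue\<close>.\<close>

type_synonym 'n heis = "(real ^ 'n) \<times> (real ^ 'n) \<times> real"

definition dirderiv :: "'a::real_normed_vector \<Rightarrow> ('a \<Rightarrow> real) \<Rightarrow> 'a \<Rightarrow> real" where
  "dirderiv v f x = frechet_derivative f (at x) v"

definition heis_X :: "'n::finite \<Rightarrow> ('n heis \<Rightarrow> real) \<Rightarrow> 'n heis \<Rightarrow> real" where
  "heis_X i f = (\<lambda>(\<xi>, \<eta>, \<tau>).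
     dirderiv (axis i 1, 0, 0) f (\<xi>, \<eta>, \<tau>) + 2 * (\<eta> $ i) * dirderiv (0, 0, 1) f (\<xi>, \<eta>, \<tau>))"

definition heis_Y :: "'n::finite \<Rightarrow> ('n heis \<Rightarrow> real) \<Rightarrow> 'n heis \<Rightarrow> real" where
  "heis_Y i f = (\<lambda>(\<xi>, \<eta>, \<tau>).
     dirderiv (0, axis i 1, 0) f (\<xi>, \<eta>, \<tau>) - 2 * (\<xi> $ i) * dirderiv (0, 0, 1) f (\<xi>, \<eta>, \<tau>))"

definition kohn_laplacian :: "('n::finite heis \<Rightarrow> real) \<Rightarrow> 'n heis \<Rightarrow> real" where
  "kohn_laplacian f x = (\<Sum>i\<in>UNIV. heis_X i (heis_X i f) x + heis_Y i (heis_Y i f) x)"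


section \<open>Function spaces\<close>

definition in_Lp :: "real \<Rightarrow> 'a::euclidean_space set \<Rightarrow> ('a \<Rightarrow> 'b::euclidean_space) \<Rightarrow> bool" where
  "in_Lp r S f \<longleftrightarrow> f \<in> borel_measurable (lebesgue_on S) \<and>
     integrable (lebesgue_on S) (\<lambda>x. norm (f x) powr r)"

definition in_L1_loc :: "('a::euclidean_space \<Rightarrow> 'b::euclidean_space) \<Rightarrow> bool" where
  "in_L1_loc f \<longleftrightarrow> (\<forall>K. compact K \<longrightarrow> integrable (lebesgue_on K) f)"

primrec Ck :: "nat \<Rightarrow> ('a::real_normed_vector \<Rightarrow> real) \<Rightarrow> bool" where
  "Ck 0 f \<longleftrightarrow> continuous_on UNIV f"
| "Ck (Suc k) f \<longleftrightarrow> (\<forall>x. f differentiable (at x)) \<and> (\<forall>v. Ck k (dirderiv v f))"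

definition Cc_infinity :: "('a::real_normed_vector \<Rightarrow> real) set" where
  "Cc_infinity = {f. (\<forall>k. Ck k f) \<and> compact (closure {x. f x \<noteq> 0})}"

text \<open>The horizontal gradient and the Kohn-Laplacian of elements of \<open>S\<^sup>2\<^sub>2\<close> are taken in the sense
  of distributions. The fields \<open>X\<^sub>i\<close>, \<open>Y\<^sub>i\<close> are divergence free, so their formal adjoints are
  \<open>-X\<^sub>i\<close>, \<open>-Y\<^sub>i\<close>, and the Kohn-Laplacian is formally self-adjoint. A gradient \<open>g\<close> is the pair of
  the vectors \<open>(X\<^sub>1 u, \<dots>, X\<^sub>n u)\<close> and \<open>(Y\<^sub>1 u, \<dots>, Y\<^sub>n u)\<close>; its product norm is Euclidean.\<close>

definition has_weak_hgrad ::
    "('n::finite heis \<Rightarrow> real) \<Rightarrow> ('n heis \<Rightarrow> (real ^ 'n) \<times> (real ^ 'n)) \<Rightarrow> bool" where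
  "has_weak_hgrad u g \<longleftrightarrow> in_L1_loc g \<and>
     (\<forall>\<phi>\<in>Cc_infinity. \<forall>i.
        (LINT x|lebesgue. u x * heis_X i \<phi> x) = - (LINT x|lebesgue. fst (g x) $ i * \<phi> x) \<and>
        (LINT x|lebesgue. u x * heis_Y i \<phi> x) = - (LINT x|lebesgue. snd (g x) $ i * \<phi> x))"

definition has_weak_kohn_laplacian ::
    "('n::finite heis \<Rightarrow> real) \<Rightarrow> ('n heis \<Rightarrow> real) \<Rightarrow> bool" where
  "has_weak_kohn_laplacian u w \<longleftrightarrow> in_L1_loc w \<and>
     (\<forall>\<phi>\<in>Cc_infinity.
        (LINT x|lebesgue. u x * kohn_laplacian \<phi> x) = (LINT x|lebesgue. w x * \<phi> x))"

text \<open>Weak derivatives are unique almost everywhere, so the choices below do not affect the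
  norms and integrals formed from them.\<close>

definition weak_hgrad ::
    "('n::finite heis \<Rightarrow> real) \<Rightarrow> 'n heis \<Rightarrow> (real ^ 'n) \<times> (real ^ 'n)" where
  "weak_hgrad u = (SOME g. has_weak_hgrad u g)"

definition weak_kohn_laplacian :: "('n::finite heis \<Rightarrow> real) \<Rightarrow> 'n heis \<Rightarrow> real" where
  "weak_kohn_laplacian u = (SOME w. has_weak_kohn_laplacian u w)"

definition S22 :: "('n::finite heis \<Rightarrow> real) set" where
  "S22 = {u. in_Lp 2 UNIV u \<and>
     (\<exists>g. has_weak_hgrad u g \<and> in_Lp 2 UNIV g) \<and>
     (\<exists>w. has_weak_kohn_laplacian u w \<and> in_Lp 2 UNIV w)}"

definition hgrad_energy :: "('n::finite heis \<Rightarrow> real) \<Rightarrow> real" where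
  "hgrad_energy u = (LINT x|lebesgue. (norm (weak_hgrad u x))\<^sup>2)"

definition kohn_energy :: "('n::finite heis \<Rightarrow> real) \<Rightarrow> real" where
  "kohn_energy u = (LINT x|lebesgue. \<bar>weak_kohn_laplacian u x\<bar>\<^sup>2)"

definition S22_norm :: "('n::finite heis \<Rightarrow> real) \<Rightarrow> real" where
  "S22_norm u = sqrt ((LINT x|lebesgue. \<bar>u x\<bar>\<^sup>2) + hgrad_energy u + kohn_energy u)"

text \<open>\<open>C\<^sup>1(0,T;S\<^sup>2\<^sub>2)\<close>: the curve \<open>t \<mapsto> u(\<cdot>,t)\<close> has a continuous strong derivative \<open>v\<close> with
  respect to \<open>S22_norm\<close>. Elements of \<open>S22\<close> are representatives of almost-everywhere classes, so
  the limits are stated through the norm.\<close>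

definition C1_S22 :: "real \<Rightarrow> ('n::finite heis \<times> real \<Rightarrow> real) \<Rightarrow> bool" where
  "C1_S22 T u \<longleftrightarrow> (\<forall>t\<in>{0<..<T}. (\<lambda>x. u (x, t)) \<in> S22) \<and>
     (\<exists>v. (\<forall>t\<in>{0<..<T}. (\<lambda>x. v (x, t)) \<in> S22 \<and>
        ((\<lambda>h. S22_norm (\<lambda>x. (u (x, t + h) - u (x, t)) / h - v (x, t))) \<longlongrightarrow> 0) (at 0) \<and>
        ((\<lambda>s. S22_norm (\<lambda>x. v (x, s) - v (x, t))) \<longlongrightarrow> 0) (at t)))"


section \<open>Weak solutions\<close>

definition Omega :: "real \<Rightarrow> ('n::finite heis \<times> real) set" where
  "Omega T = UNIV \<times> {0<..<T}"

definition time_deriv :: "real \<Rightarrow> ('n::finite heis \<times> real \<Rightarrow> real) \<Rightarrow> 'n heis \<times> real \<Rightarrow> real" where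
  "time_deriv T \<phi> = (\<lambda>(x, t). vector_derivative (\<lambda>s. \<phi> (x, s)) (at t within {0..T}))"

text \<open>\<open>C\<^sup>2\<^sup>,\<^sup>1\<close> on the closed strip, with one-sided time derivatives at \<open>0\<close> and \<open>T\<close>. Regularity up
  to \<open>t = 0\<close> is what gives a meaning to \<open>\<phi>(x,0)\<close>.\<close>

definition C21 :: "real \<Rightarrow> ('n::finite heis \<times> real \<Rightarrow> real) \<Rightarrow> bool" where
  "C21 T \<phi> \<longleftrightarrow>
     continuous_on (UNIV \<times> {0..T}) \<phi> \<and>
     (\<forall>x. \<forall>t\<in>{0..T}. (\<lambda>s. \<phi> (x, s)) differentiable (at t within {0..T})) \<and>
     continuous_on (UNIV \<times> {0..T}) (time_deriv T \<phi>) \<and>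
     (\<forall>x. \<forall>t\<in>{0..T}. (\<lambda>y. \<phi> (y, t)) differentiable (at x)) \<and>
     (\<forall>v. continuous_on (UNIV \<times> {0..T}) (\<lambda>(x, t). dirderiv v (\<lambda>y. \<phi> (y, t)) x)) \<and>
     (\<forall>v x. \<forall>t\<in>{0..T}. dirderiv v (\<lambda>y. \<phi> (y, t)) differentiable (at x)) \<and>
     (\<forall>v w. continuous_on (UNIV \<times> {0..T})
        (\<lambda>(x, t). dirderiv w (dirderiv v (\<lambda>y. \<phi> (y, t))) x))"

text \<open>Test functions have compact support in \<open>UNIV \<times> {0..T}\<close>, as needed for the integrals against
  locally integrable data and for \<open>\<phi> = 1\<close> to be excluded. They are not required to vanish at
  \<open>t = T\<close>: the weak formulation contains no boundary term there, and the test class carries no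
  condition there either.\<close>

definition test_function :: "real \<Rightarrow> ('n::finite heis \<times> real \<Rightarrow> real) \<Rightarrow> bool" where
  "test_function T \<phi> \<longleftrightarrow> C21 T \<phi> \<and> (\<forall>z\<in>UNIV \<times> {0..T}. 0 \<le> \<phi> z) \<and>
     compact (closure {z\<in>UNIV \<times> {0..T}. \<phi> z \<noteq> 0})"

definition M_at :: "(real \<times> real \<times> real \<times> real \<times> real \<Rightarrow> real) \<Rightarrow>
    ('n::finite heis \<times> real \<Rightarrow> real) \<Rightarrow> ('n heis \<times> real \<Rightarrow> real) \<Rightarrow> real \<Rightarrow> real" where
  "M_at M u \<omega> t = M (t,
     hgrad_energy (\<lambda>x. u (x, t)), hgrad_energy (\<lambda>x. \<omega> (x, t)),
     kohn_energy (\<lambda>x. u (x, t)), kohn_energy (\<lambda>x. \<omega> (x, t)))"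

text \<open>The weak form of \<open>f\<^sub>t - m(t) \<Delta> f = \<bar>g\<bar>\<^sup>r\<close>, \<open>f(\<cdot>,0) = f\<^sub>0\<close>. Since \<open>lebesgue_integral\<close> is
  \<open>0\<close> on non-integrable functions, existence of the four integrals is stated explicitly.\<close>

definition weak_equation :: "real \<Rightarrow> real \<Rightarrow> (real \<Rightarrow> real) \<Rightarrow> ('n::finite heis \<Rightarrow> real) \<Rightarrow>
    ('n heis \<times> real \<Rightarrow> real) \<Rightarrow> ('n heis \<times> real \<Rightarrow> real) \<Rightarrow> bool" where
  "weak_equation T r m f0 f g \<longleftrightarrow> (\<forall>\<phi>. test_function T \<phi> \<longrightarrow>
     integrable (lebesgue_on (Omega T)) (\<lambda>z. \<bar>g z\<bar> powr r * \<phi> z) \<and>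
     integrable lebesgue (\<lambda>x. f0 x * \<phi> (x, 0)) \<and>
     integrable (lebesgue_on (Omega T)) (\<lambda>z. f z * time_deriv T \<phi> z) \<and>
     integrable (lebesgue_on (Omega T))
       (\<lambda>(x, t). m t * f (x, t) * kohn_laplacian (\<lambda>y. \<phi> (y, t)) x) \<and>
     (LINT z|lebesgue_on (Omega T). \<bar>g z\<bar> powr r * \<phi> z) + (LINT x|lebesgue. f0 x * \<phi> (x, 0)) =
       - (LINT z|lebesgue_on (Omega T). f z * time_deriv T \<phi> z)
       - (LINT (x, t)|lebesgue_on (Omega T).
            m t * f (x, t) * kohn_laplacian (\<lambda>y. \<phi> (y, t)) x))"

definition weak_solution :: "real \<Rightarrow> real \<Rightarrow> real \<Rightarrow>
    (real \<times> real \<times> real \<times> real \<times> real \<Rightarrow> real) \<Rightarrow>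
    (real \<times> real \<times> real \<times> real \<times> real \<Rightarrow> real) \<Rightarrow>
    ('n::finite heis \<Rightarrow> real) \<Rightarrow> ('n heis \<Rightarrow> real) \<Rightarrow>
    ('n heis \<times> real \<Rightarrow> real) \<Rightarrow> ('n heis \<times> real \<Rightarrow> real) \<Rightarrow> bool" where
  "weak_solution T p q M1 M2 u0 \<omega>0 u \<omega> \<longleftrightarrow>
     C1_S22 T u \<and> in_Lp q (Omega T) u \<and>
     C1_S22 T \<omega> \<and> in_Lp p (Omega T) \<omega> \<and>
     in_L1_loc u0 \<and> (AE x in lebesgue. 0 \<le> u0 x) \<and>
     in_L1_loc \<omega>0 \<and> (AE x in lebesgue. 0 \<le> \<omega>0 x) \<and>
     weak_equation T p (M_at M1 u \<omega>) u0 u \<omega> \<and>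
     weak_equation T q (M_at M2 u \<omega>) \<omega>0 \<omega> u"

definition nontrivial ::
    "real \<Rightarrow> ('n::finite heis \<times> real \<Rightarrow> real) \<Rightarrow> ('n heis \<times> real \<Rightarrow> real) \<Rightarrow> bool" where
  "nontrivial T u \<omega> \<longleftrightarrow> \<not> (AE z in lebesgue_on (Omega T). u z = 0 \<and> \<omega> z = 0)"

end

theory Submission
  imports Defs
begin

text \<open>
  Since test functions need not vanish at \<open>t = T\<close>, they may be taken independent of time. Testing with
  a cutoff \<open>\<phi>\<^sub>R\<close> to the Koranyi ball of radius \<open>R\<close>, for which \<open>\<bar>\<Delta> \<phi>\<^sub>R\<bar> \<le> C / R\<^sup>2\<close>, bounds the integral of
  \<open>\<bar>g\<bar>\<^sup>r \<phi>\<^sub>R\<close> by \<open>C / R\<^sup>2\<close> times the integral of \<open>\<bar>f\<bar>\<close> over a set of measure of order \<open>R\<close> to the \<open>Q\<close>.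
  As \<open>f \<in> L\<^sup>s\<close>, this tends to \<open>0\<close> when \<open>Q (s - 1) < 2 s\<close>; then \<open>g = 0\<close>, and the other equation gives
  \<open>f = 0\<close>. The hypothesis \<open>Q < max A\<^sub>1 A\<^sub>2\<close> implies \<open>Q (s - 1) < 2 s\<close> for \<open>s = min p q\<close>, so a single
  equation suffices to start.
\<close>

section \<open>Truncated powers, and the horizontal fields as derivatives\<close>

lemma max0_power_has_real_derivative:
  "((\<lambda>s. (max 0 s) ^ Suc (Suc k)) has_real_derivative real (Suc (Suc k)) * (max 0 s) ^ Suc k) (at s)"
proof -
  consider "s < 0" | "s > 0" | "s = 0" by linarith
  then show ?thesis
  proof cases
    case 1
    have "((\<lambda>s::real. 0) has_real_derivative 0) (at s)" by simp
    then have "((\<lambda>s. (max 0 s) ^ Suc (Suc k)) has_real_derivative 0) (at s)"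
      by (rule has_field_derivative_transform_within_open[of _ _ _ "{..<0}"]) (use 1 in auto)
    then show ?thesis using 1 by simp
  next
    case 2
    have "((\<lambda>s::real. s ^ Suc (Suc k)) has_real_derivative real (Suc (Suc k)) * s ^ Suc k) (at s)"
      using DERIV_pow[of "Suc (Suc k)" s] by simp
    then have "((\<lambda>s. (max 0 s) ^ Suc (Suc k)) has_real_derivative real (Suc (Suc k)) * s ^ Suc k) (at s)"
      by (rule has_field_derivative_transform_within_open[of _ _ _ "{0<..}"]) (use 2 in auto)
    then show ?thesis using 2 by simp
  next
    case 3
    \<comment> \<open>At the kink the difference quotient is at most
      \<open>\<bar>y\<bar> ^ Suc k\<close> in modulus, so an exponent of at least 2 gives derivative
      0.\<close>
    have "((\<lambda>y::real. \<bar>y\<bar> ^ Suc k) \<longlongrightarrow> \<bar>0\<bar> ^ Suc k) (at 0)" by (intro tendsto_intros)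
    then have "((\<lambda>y::real. max 0 y ^ Suc (Suc k) / y) \<longlongrightarrow> 0) (at 0)"
      by (rule_tac tendsto_0_le[where K=1]) (auto simp: max_def eventually_at_filter abs_mult power_abs)
    then show ?thesis using 3 by (simp add: has_field_derivative_iff)
  qed
qed

lemma has_derivative_max0_power:
  assumes "(h has_derivative h') (at x)"
  shows "((\<lambda>x. (max 0 (h x)) ^ Suc (Suc k)) has_derivative
    (\<lambda>v. real (Suc (Suc k)) * (max 0 (h x)) ^ Suc k * h' v)) (at x)"
  using has_derivative_compose[OF assms
      max0_power_has_real_derivative[of k "h x", unfolded has_field_derivative_def]]
  by simp

lemma dirderiv_eq: "(f has_derivative f') (at x) \<Longrightarrow> dirderiv v f x = f' v"
  unfolding dirderiv_def by (metis frechet_derivative_at)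

text \<open>By linearity of the total derivative the two directional derivatives in
  \<open>heis_X\<close> merge into one, along the tangent vector of the field. One
  \<open>has_derivative\<close> fact then serves all the fields.\<close>

lemma heis_X_eq:
  assumes "(f has_derivative f') (at x)"
  shows "heis_X i f x = f' (axis i 1, 0, 2 * fst (snd x) $ i)"
proof -
  interpret f': linear f' using assms by (rule has_derivative_linear)
  obtain \<xi> \<eta> \<tau> where x: "x = (\<xi>, \<eta>, \<tau>)" by (cases x) auto
  have "f' (axis i 1, 0, 2 * \<eta> $ i) = f' ((axis i 1, 0, 0) + (2 * \<eta> $ i) *\<^sub>R (0, 0, 1))"
    by simp
  then show ?thesis
    using assms unfolding x fst_conv snd_conv
    by (simp only: f'.add f'.scaleR) (simp add: heis_X_def dirderiv_eq)
qed

lemma heis_Y_eq: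
  assumes "(f has_derivative f') (at x)"
  shows "heis_Y i f x = f' (0, axis i 1, - 2 * fst x $ i)"
proof -
  interpret f': linear f' using assms by (rule has_derivative_linear)
  obtain \<xi> \<eta> \<tau> where x: "x = (\<xi>, \<eta>, \<tau>)" by (cases x) auto
  have "f' (0, axis i 1, - 2 * \<xi> $ i) = f' ((0, axis i 1, 0) + (- 2 * \<xi> $ i) *\<^sub>R (0, 0, 1))"
    by simp
  then show ?thesis
    using assms unfolding x fst_conv by (simp only: f'.add f'.scaleR) (simp add: heis_Y_def dirderiv_eq)
qed

section \<open>The Koranyi gauge, its cutoff and their derivatives\<close>

definition hsq :: "'n::finite heis \<Rightarrow> real" where
  "hsq x = fst x \<bullet> fst x + fst (snd x) \<bullet> fst (snd x)"

text \<open>The fourth power of the Koranyi gauge: a polynomial, hence smooth at the origin too, and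
  homogeneous of degree 4 under the dilations, hence compared with \<open>R ^ 4\<close>.\<close>

definition koranyi :: "'n::finite heis \<Rightarrow> real" where
  "koranyi x = (hsq x)\<^sup>2 + (snd (snd x))\<^sup>2"

text \<open>The direction comes first, so that \<open>koranyi_deriv v\<close> is a function of the
  point and can be differentiated again.\<close>

definition koranyi_deriv :: "'n::finite heis \<Rightarrow> 'n heis \<Rightarrow> real" where
  "koranyi_deriv v x = 4 * hsq x * (fst x \<bullet> fst v + fst (snd x) \<bullet> fst (snd v))
     + 2 * snd (snd x) * snd (snd v)"

text \<open>Cubing leaves a factor \<open>max 0 (1 - koranyi x / R ^ 4)\<close> in the second
  derivatives, so they are continuous across the gauge sphere of radius \<open>R\<close>.\<close>

definition cutoff :: "real \<Rightarrow> 'n::finite heis \<Rightarrow> real" where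
  "cutoff R x = (max 0 (1 - koranyi x / R ^ 4)) ^ 3"

lemma hsq_has_derivative:
  "(hsq has_derivative (\<lambda>v. 2 * (fst x \<bullet> fst v + fst (snd x) \<bullet> fst (snd v)))) (at x)"
  unfolding hsq_def[abs_def]
  by (auto intro!: derivative_eq_intros simp: inner_commute)

lemma koranyi_has_derivative:
  "(koranyi has_derivative (\<lambda>v. koranyi_deriv v x)) (at x)"
  unfolding koranyi_def[abs_def] koranyi_deriv_def
  by (auto intro!: derivative_eq_intros hsq_has_derivative simp: algebra_simps)

lemma koranyi_deriv_has_derivative:
  "(koranyi_deriv v has_derivative (\<lambda>w. 8 * (fst x \<bullet> fst w + fst (snd x) \<bullet> fst (snd w)) *
       (fst x \<bullet> fst v + fst (snd x) \<bullet> fst (snd v))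
     + 4 * hsq x * (fst w \<bullet> fst v + fst (snd w) \<bullet> fst (snd v))
     + 2 * snd (snd w) * snd (snd v))) (at x)"
  unfolding koranyi_deriv_def[abs_def]
  by (auto intro!: derivative_eq_intros hsq_has_derivative ext simp: algebra_simps)

lemma one_minus_koranyi_has_derivative:
  "((\<lambda>x. 1 - koranyi x / R ^ 4) has_derivative (\<lambda>v. - koranyi_deriv v x / R ^ 4)) (at x)"
  unfolding divide_inverse
  by (rule derivative_eq_intros koranyi_has_derivative refl)+ simp

lemma cutoff_has_derivative:
  "(cutoff R has_derivative
     (\<lambda>v. - 3 / R ^ 4 * (max 0 (1 - koranyi x / R ^ 4))\<^sup>2 * koranyi_deriv v x)) (at x)"
  using has_derivative_max0_power[OF one_minus_koranyi_has_derivative, where k = 1]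
  by (simp add: cutoff_def[abs_def] eval_nat_numeral algebra_simps)

lemma cutoff_factor_has_derivative:
  "((\<lambda>x. (max 0 (1 - koranyi x / R ^ 4))\<^sup>2) has_derivative
     (\<lambda>v. - 2 / R ^ 4 * max 0 (1 - koranyi x / R ^ 4) * koranyi_deriv v x)) (at x)"
  using has_derivative_max0_power[OF one_minus_koranyi_has_derivative, where k = 0]
  by (simp add: eval_nat_numeral algebra_simps)

lemma dirderiv_cutoff:
  "dirderiv v (cutoff R) =
     (\<lambda>x. - 3 / R ^ 4 * (max 0 (1 - koranyi x / R ^ 4))\<^sup>2 * koranyi_deriv v x)"
  by (rule ext) (rule dirderiv_eq[OF cutoff_has_derivative])

lemma dirderiv_cutoff_has_derivative:
  "(dirderiv v (cutoff R) has_derivative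
     (\<lambda>w. 6 / R ^ 8 * max 0 (1 - koranyi x / R ^ 4) * koranyi_deriv w x * koranyi_deriv v x
       - 3 / R ^ 4 * (max 0 (1 - koranyi x / R ^ 4))\<^sup>2 *
       (8 * (fst x \<bullet> fst w + fst (snd x) \<bullet> fst (snd w)) *
       (fst x \<bullet> fst v + fst (snd x) \<bullet> fst (snd v))
     + 4 * hsq x * (fst w \<bullet> fst v + fst (snd w) \<bullet> fst (snd v))
     + 2 * snd (snd w) * snd (snd v)))) (at x)"
  unfolding dirderiv_cutoff
  by (rule derivative_eq_intros cutoff_factor_has_derivative koranyi_deriv_has_derivative refl ext)+
    (simp add: algebra_simps flip: power_add)

lemma continuous_hsq: "continuous_on S hsq"
  unfolding hsq_def[abs_def] by (intro continuous_intros)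

lemma continuous_koranyi: "continuous_on S koranyi"
  unfolding koranyi_def[abs_def] by (intro continuous_intros continuous_hsq)

lemma continuous_koranyi_deriv: "continuous_on S (koranyi_deriv v)"
  unfolding koranyi_deriv_def[abs_def] by (intro continuous_intros continuous_hsq)

lemma continuous_cutoff: "continuous_on S (cutoff R)"
  unfolding cutoff_def[abs_def] divide_inverse by (intro continuous_intros continuous_koranyi)

lemma continuous_dirderiv_cutoff: "continuous_on S (dirderiv v (cutoff R))"
  unfolding dirderiv_cutoff divide_inverse
  by (intro continuous_intros continuous_koranyi continuous_koranyi_deriv)

lemma continuous_dirderiv_dirderiv_cutoff:
  "continuous_on S (dirderiv w (dirderiv v (cutoff R)))"
  unfolding dirderiv_eq[OF dirderiv_cutoff_has_derivative, abs_def] divide_inverse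
  by (intro continuous_intros continuous_koranyi continuous_koranyi_deriv continuous_hsq)

lemma continuous_on_fst_compose:
  assumes "continuous_on UNIV f"
  shows "continuous_on S (\<lambda>(x, t). f x)"
  unfolding split_def by (intro continuous_on_compose2[OF assms] continuous_intros) auto

text \<open>For \<open>T > 0\<close> the interval \<open>{0..T}\<close> is nondegenerate, so
  derivatives within it are unique, at its endpoints too.\<close>

lemma time_deriv_const:
  assumes "T > 0" "t \<in> {0..T}"
  shows "time_deriv T (\<lambda>z. f (fst z)) (x, t) = 0"
  using vector_derivative_within_cbox[of 0 T t "\<lambda>_. f x" 0] assms
  by (simp add: time_deriv_def)

section \<open>Size of the gauge ball\<close>

lemma hsq_nonneg: "0 \<le> hsq x" by (simp add: hsq_def)
lemma koranyi_nonneg: "0 \<le> koranyi x" by (simp add: koranyi_def)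

text \<open>Each of the two squares in \<open>koranyi\<close> is at most \<open>R ^ 4\<close>;
  horizontal coordinates therefore scale like \<open>R\<close>, the vertical one like
  \<open>R\<^sup>2\<close>.\<close>

lemma koranyi_lessD:
  assumes "koranyi x < R ^ 4" "R > 0"
  shows "hsq x \<le> R\<^sup>2" "\<bar>snd (snd x)\<bar> \<le> R\<^sup>2" "\<bar>fst x $ i\<bar> \<le> R" "\<bar>fst (snd x) $ i\<bar> \<le> R"
proof -
  have "(hsq x)\<^sup>2 + (snd (snd x))\<^sup>2 < (R\<^sup>2)\<^sup>2"
    using assms by (simp add: koranyi_def flip: power_mult)
  then have "(hsq x)\<^sup>2 \<le> (R\<^sup>2)\<^sup>2" "(snd (snd x))\<^sup>2 \<le> (R\<^sup>2)\<^sup>2"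
    using zero_le_power2[of "hsq x"] zero_le_power2[of "snd (snd x)"] by linarith+
  then show h: "hsq x \<le> R\<^sup>2" and "\<bar>snd (snd x)\<bar> \<le> R\<^sup>2"
    by (auto intro: power2_le_imp_le simp: abs_le_square_iff)
  have "(norm (fst x))\<^sup>2 \<le> R\<^sup>2" "(norm (fst (snd x)))\<^sup>2 \<le> R\<^sup>2"
    using h unfolding hsq_def power2_norm_eq_inner by (smt (verit) inner_ge_zero)+
  then have "norm (fst x) \<le> R" "norm (fst (snd x)) \<le> R"
    using assms(2) by (auto intro: power2_le_imp_le)
  then show "\<bar>fst x $ i\<bar> \<le> R" "\<bar>fst (snd x) $ i\<bar> \<le> R"
    using component_le_norm_cart[of "fst x" i] component_le_norm_cart[of "fst (snd x)" i] by linarith+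
qed

text \<open>A box scaled like the dilations stands in for the gauge ball, because its volume is
  explicit and of the same order.\<close>

definition heis_box :: "real \<Rightarrow> 'n::finite heis set" where
  "heis_box R = cbox ((\<chi> i. - R), (\<chi> i. - R), - R\<^sup>2) ((\<chi> i. R), (\<chi> i. R), R\<^sup>2)"

lemma koranyi_less_heis_box:
  assumes "koranyi x < R ^ 4" "R > 0"
  shows "x \<in> heis_box R"
proof -
  obtain \<xi> \<eta> \<tau> where x: "x = (\<xi>, \<eta>, \<tau>)" by (cases x) auto
  have abs_interval: "\<bar>y\<bar> \<le> a \<longleftrightarrow> - a \<le> y \<and> y \<le> a" for y a :: real by linarith
  show ?thesis
    using koranyi_lessD[OF assms]
    by (simp add: heis_box_def x cbox_Pair_iff mem_box_cart abs_interval)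
qed

text \<open>The exponent exceeds the topological dimension by one because the vertical side has
  length \<open>2 * R\<^sup>2\<close>; this is how the homogeneous dimension enters.\<close>

lemma content_heis_box:
  assumes "R > 0"
  shows "measure lborel (heis_box R :: 'n::finite heis set) =
    2 ^ (2 * CARD('n) + 1) * R powr (2 * real CARD('n) + 2)"
proof -
  have "measure lborel (cbox (\<chi> i. - R) (\<chi> i. R) :: (real ^ 'n) set) = (2 * R) ^ CARD('n)"
    using assms by (subst content_cbox_cart) (auto simp: interval_ne_empty_cart)
  moreover have "measure lborel {- R\<^sup>2..R\<^sup>2} = 2 * R\<^sup>2" by simp
  ultimately have "measure lborel (heis_box R :: 'n heis set) = (2 * R) ^ CARD('n) * ((2 * R) ^ CARD('n) * (2 * R\<^sup>2))"
    by (simp only: heis_box_def content_Pair box_real)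
  also have "\<dots> = 2 ^ (2 * CARD('n) + 1) * R ^ (2 * CARD('n) + 2)"
    unfolding power_mult_distrib power_add power_even_eq by (simp add: power2_eq_square)
  also have "R ^ (2 * CARD('n) + 2) = R powr real (2 * CARD('n) + 2)"
    using assms by (rule powr_realpow[symmetric])
  finally show ?thesis by (simp only: of_nat_add of_nat_mult of_nat_numeral)
qed

section \<open>The cutoff as a test function\<close>

lemma cutoff_nonneg: "0 \<le> cutoff R x" by (simp add: cutoff_def)

lemma cutoff_le_1: "cutoff R x \<le> 1"
  unfolding cutoff_def by (intro power_le_one) (auto simp: koranyi_nonneg)

lemma cutoff_eq_0: "R > 0 \<Longrightarrow> \<not> koranyi x < R ^ 4 \<Longrightarrow> cutoff R x = 0"
  by (simp add: cutoff_def max_def field_simps)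

lemma test_function_cutoff:
  assumes "T > 0" "R > 0"
  shows "test_function T (\<lambda>z. cutoff R (fst z) :: real)"
proof -
  have "C21 T (\<lambda>z. cutoff R (fst z))"
    unfolding C21_def
  proof (intro conjI allI ballI)
    show "continuous_on (UNIV \<times> {0..T}) (\<lambda>z. cutoff R (fst z))"
      using continuous_on_fst_compose[OF continuous_cutoff] by (simp add: split_def)
    show "continuous_on (UNIV \<times> {0..T}) (time_deriv T (\<lambda>z. cutoff R (fst z)))"
      by (rule continuous_on_eq[of _ "\<lambda>_. 0"]) (auto simp: time_deriv_const assms)
  next
    fix v x t show "dirderiv v (\<lambda>y. cutoff R (fst (y, t))) differentiable at x"
      using dirderiv_cutoff_has_derivative unfolding differentiable_def fst_conv by blast
  next
    fix x t show "(\<lambda>y. cutoff R (fst (y, t))) differentiable at x"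
      using cutoff_has_derivative unfolding differentiable_def fst_conv by blast
  qed (simp_all add: continuous_on_fst_compose continuous_dirderiv_cutoff
      continuous_dirderiv_dirderiv_cutoff)
  moreover have "compact (closure {z\<in>UNIV \<times> {0..T}. cutoff R (fst z :: 'n::finite heis) \<noteq> 0})"
  proof -
    have "{z\<in>UNIV \<times> {0..T}. cutoff R (fst z) \<noteq> 0} \<subseteq> (heis_box R :: 'n heis set) \<times> {0..T}"
    proof (intro subsetI)
      fix z :: "'n heis \<times> real" assume z: "z \<in> {z\<in>UNIV \<times> {0..T}. cutoff R (fst z) \<noteq> 0}"
      then have "koranyi (fst z) < R ^ 4" using cutoff_eq_0[OF assms(2)] by blast
      then have "fst z \<in> heis_box R" using assms(2) by (rule koranyi_less_heis_box)
      then show "z \<in> heis_box R \<times> {0..T}" using z by (simp add: mem_Times_iff)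
    qed
    moreover have "bounded ((heis_box R :: 'n heis set) \<times> {0..T})"
      unfolding heis_box_def by (intro bounded_Times) auto
    ultimately show ?thesis
      unfolding compact_closure by (rule bounded_subset[rotated])
  qed
  ultimately show ?thesis by (simp add: test_function_def cutoff_nonneg)
qed

section \<open>The Kohn-Laplacian of the cutoff\<close>

text \<open>This is \<open>koranyi_deriv\<close> along the tangent vector
  \<open>(axis i 1, 0, 2 * fst (snd x) $ i)\<close>, homogeneous of degree 3.\<close>

definition X_koranyi :: "'n::finite \<Rightarrow> 'n heis \<Rightarrow> real" where
  "X_koranyi i x = 4 * hsq x * fst x $ i + 4 * snd (snd x) * fst (snd x) $ i"

definition Y_koranyi :: "'n::finite \<Rightarrow> 'n heis \<Rightarrow> real" where
  "Y_koranyi i x = 4 * hsq x * fst (snd x) $ i - 4 * snd (snd x) * fst x $ i"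

lemma heis_X_cutoff:
  "heis_X i (cutoff R) = (\<lambda>x. - 3 / R ^ 4 * (max 0 (1 - koranyi x / R ^ 4))\<^sup>2 * X_koranyi i x)"
  by (rule ext)
    (simp add: heis_X_eq[OF cutoff_has_derivative] koranyi_deriv_def X_koranyi_def inner_axis)

lemma heis_Y_cutoff:
  "heis_Y i (cutoff R) = (\<lambda>x. - 3 / R ^ 4 * (max 0 (1 - koranyi x / R ^ 4))\<^sup>2 * Y_koranyi i x)"
  by (rule ext)
    (simp add: heis_Y_eq[OF cutoff_has_derivative] koranyi_deriv_def Y_koranyi_def inner_axis)

lemma X_koranyi_has_derivative:
  "(X_koranyi i has_derivative (\<lambda>w. 8 * (fst x \<bullet> fst w + fst (snd x) \<bullet> fst (snd w)) * fst x $ i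
     + 4 * hsq x * fst w $ i + 4 * snd (snd w) * fst (snd x) $ i
     + 4 * snd (snd x) * fst (snd w) $ i)) (at x)"
  unfolding X_koranyi_def[abs_def]
  by (rule derivative_eq_intros hsq_has_derivative refl
      bounded_linear.has_derivative[OF bounded_linear_vec_nth])+
    (simp add: algebra_simps)

lemma Y_koranyi_has_derivative:
  "(Y_koranyi i has_derivative (\<lambda>w. 8 * (fst x \<bullet> fst w + fst (snd x) \<bullet> fst (snd w)) * fst (snd x) $ i
     + 4 * hsq x * fst (snd w) $ i - 4 * snd (snd w) * fst x $ i
     - 4 * snd (snd x) * fst w $ i)) (at x)"
  unfolding Y_koranyi_def[abs_def]
  by (rule derivative_eq_intros hsq_has_derivative refl
      bounded_linear.has_derivative[OF bounded_linear_vec_nth])+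
    (simp add: algebra_simps)

text \<open>Both fields turn the cutoff into the same truncated factor times a polynomial, so one
  product rule covers the second application of either.\<close>

lemma cutoff_factor_times_has_derivative:
  assumes "(h has_derivative h') (at x)"
  shows "((\<lambda>x. - 3 / R ^ 4 * (max 0 (1 - koranyi x / R ^ 4))\<^sup>2 * h x) has_derivative
     (\<lambda>v. 6 / R ^ 8 * max 0 (1 - koranyi x / R ^ 4) * koranyi_deriv v x * h x
        - 3 / R ^ 4 * (max 0 (1 - koranyi x / R ^ 4))\<^sup>2 * h' v)) (at x)"
  by (rule derivative_eq_intros cutoff_factor_has_derivative assms refl ext)+
    (simp add: algebra_simps flip: power_add)

text \<open>The chain rule yields a squared gradient of the gauge and a second-order term. The
  second derivatives of \<open>koranyi\<close> along the two fields of index \<open>i\<close>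
  coincide, which doubles the coefficients 8, 8, 4 to 16, 16, 8.\<close>

lemma kohn_laplacian_cutoff:
  "kohn_laplacian (cutoff R) x = (\<Sum>i\<in>UNIV.
     6 / R ^ 8 * max 0 (1 - koranyi x / R ^ 4) * ((X_koranyi i x)\<^sup>2 + (Y_koranyi i x)\<^sup>2)
     - 3 / R ^ 4 * (max 0 (1 - koranyi x / R ^ 4))\<^sup>2 *
       (16 * (fst x $ i)\<^sup>2 + 16 * (fst (snd x) $ i)\<^sup>2 + 8 * hsq x))"
proof -
  have X: "heis_X i (heis_X i (cutoff R)) x =
      6 / R ^ 8 * max 0 (1 - koranyi x / R ^ 4) * (X_koranyi i x)\<^sup>2
      - 3 / R ^ 4 * (max 0 (1 - koranyi x / R ^ 4))\<^sup>2 *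
       (8 * (fst x $ i)\<^sup>2 + 8 * (fst (snd x) $ i)\<^sup>2 + 4 * hsq x)" for i
    unfolding heis_X_cutoff
      heis_X_eq[OF cutoff_factor_times_has_derivative[OF X_koranyi_has_derivative]]
    by (simp add: koranyi_deriv_def X_koranyi_def inner_axis) (simp add: algebra_simps power2_eq_square)
  have Y: "heis_Y i (heis_Y i (cutoff R)) x =
      6 / R ^ 8 * max 0 (1 - koranyi x / R ^ 4) * (Y_koranyi i x)\<^sup>2
      - 3 / R ^ 4 * (max 0 (1 - koranyi x / R ^ 4))\<^sup>2 *
       (8 * (fst x $ i)\<^sup>2 + 8 * (fst (snd x) $ i)\<^sup>2 + 4 * hsq x)" for i
    unfolding heis_Y_cutoff
      heis_Y_eq[OF cutoff_factor_times_has_derivative[OF Y_koranyi_has_derivative]]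
    by (simp add: koranyi_deriv_def Y_koranyi_def inner_axis) (simp add: algebra_simps power2_eq_square)
  show ?thesis
    unfolding kohn_laplacian_def X Y
    by (intro sum.cong refl) (simp add: algebra_simps add_divide_distrib)
qed

lemma kohn_laplacian_cutoff_eq_0:
  "R > 0 \<Longrightarrow> \<not> koranyi x < R ^ 4 \<Longrightarrow> kohn_laplacian (cutoff R) x = 0"
  unfolding kohn_laplacian_cutoff by (intro sum.neutral) (simp add: max_def field_simps)

text \<open>Homogeneity gives the rate: degree 6 against \<open>R ^ 8\<close>, degree 2 against
  \<open>R ^ 4\<close>. The constant is \<open>6 * 128 + 3 * 40\<close> for each
  \<open>i\<close>.\<close>

lemma abs_kohn_laplacian_cutoff_le:
  fixes x :: "'n::finite heis"
  assumes "R > 0"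
  shows "\<bar>kohn_laplacian (cutoff R) x\<bar> \<le> 888 * real CARD('n) / R\<^sup>2"
proof (cases "koranyi x < R ^ 4")
  case False
  then show ?thesis using assms by (simp add: kohn_laplacian_cutoff_eq_0)
next
  case True
  define M where "M = max 0 (1 - koranyi x / R ^ 4)"
  have M: "0 \<le> M" "M \<le> 1" using assms by (auto simp: M_def koranyi_nonneg)
  then have M2: "0 \<le> M\<^sup>2" "M\<^sup>2 \<le> 1" by (auto intro: power_le_one)
  have "\<bar>6 / R ^ 8 * M * ((X_koranyi i x)\<^sup>2 + (Y_koranyi i x)\<^sup>2)
     - 3 / R ^ 4 * M\<^sup>2 * (16 * (fst x $ i)\<^sup>2 + 16 * (fst (snd x) $ i)\<^sup>2 + 8 * hsq x)\<bar>
     \<le> 888 / R\<^sup>2" for i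
  proof -
    note b = koranyi_lessD[OF True assms]
    have m: "\<bar>hsq x * y\<bar> \<le> R ^ 3" "\<bar>snd (snd x) * y\<bar> \<le> R ^ 3" if "\<bar>y\<bar> \<le> R" for y
      using mult_mono[of "\<bar>hsq x\<bar>" "R\<^sup>2" "\<bar>y\<bar>" R] mult_mono[of "\<bar>snd (snd x)\<bar>" "R\<^sup>2" "\<bar>y\<bar>" R]
        b that assms hsq_nonneg[of x] by (simp_all add: abs_mult eval_nat_numeral)
    have "\<bar>X_koranyi i x\<bar> \<le> 8 * R ^ 3" "\<bar>Y_koranyi i x\<bar> \<le> 8 * R ^ 3"
      unfolding X_koranyi_def Y_koranyi_def
      using m[OF b(3)[of i]] m[OF b(4)[of i]] by (simp_all add: mult.assoc)
    then have "(X_koranyi i x)\<^sup>2 \<le> (8 * R ^ 3)\<^sup>2" "(Y_koranyi i x)\<^sup>2 \<le> (8 * R ^ 3)\<^sup>2"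
      using power_mono[of "\<bar>X_koranyi i x\<bar>" "8 * R ^ 3" 2] power_mono[of "\<bar>Y_koranyi i x\<bar>" "8 * R ^ 3" 2]
      by (simp_all only: power2_abs abs_ge_zero simp_thms)
    then have "(X_koranyi i x)\<^sup>2 + (Y_koranyi i x)\<^sup>2 \<le> 128 * R ^ 6"
      by (simp add: power_mult_distrib flip: power_mult)
    then have "M * ((X_koranyi i x)\<^sup>2 + (Y_koranyi i x)\<^sup>2) \<le> 1 * (128 * R ^ 6)"
      using M by (intro mult_mono) auto
    then have 1: "6 / R ^ 8 * (M * ((X_koranyi i x)\<^sup>2 + (Y_koranyi i x)\<^sup>2)) \<le> 6 / R ^ 8 * (128 * R ^ 6)"
      using assms by (intro mult_left_mono) auto
    have "(fst x $ i)\<^sup>2 \<le> R\<^sup>2" "(fst (snd x) $ i)\<^sup>2 \<le> R\<^sup>2"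
      using b(3,4)[of i] assms by (simp_all add: abs_le_square_iff[symmetric])
    then have "16 * (fst x $ i)\<^sup>2 + 16 * (fst (snd x) $ i)\<^sup>2 + 8 * hsq x \<le> 40 * R\<^sup>2"
      using b(1) by simp
    then have "M\<^sup>2 * (16 * (fst x $ i)\<^sup>2 + 16 * (fst (snd x) $ i)\<^sup>2 + 8 * hsq x) \<le> 1 * (40 * R\<^sup>2)"
      using M2 by (intro mult_mono) (auto simp: hsq_nonneg)
    then have 2: "3 / R ^ 4 * (M\<^sup>2 * (16 * (fst x $ i)\<^sup>2 + 16 * (fst (snd x) $ i)\<^sup>2 + 8 * hsq x))
        \<le> 3 / R ^ 4 * (40 * R\<^sup>2)"
      using assms by (intro mult_left_mono) auto
    have 3: "0 \<le> 6 / R ^ 8 * (M * ((X_koranyi i x)\<^sup>2 + (Y_koranyi i x)\<^sup>2))"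
      "0 \<le> 3 / R ^ 4 * (M\<^sup>2 * (16 * (fst x $ i)\<^sup>2 + 16 * (fst (snd x) $ i)\<^sup>2 + 8 * hsq x))"
      using M M2 hsq_nonneg[of x] by auto
    have 4: "6 / R ^ 8 * (128 * R ^ 6) = 768 / R\<^sup>2" "3 / R ^ 4 * (40 * R\<^sup>2) = 120 / R\<^sup>2"
      "888 / R\<^sup>2 = 768 / R\<^sup>2 + 120 / R\<^sup>2"
      using power_add[of R 2 6] power_add[of R 2 2] assms by (simp_all add: divide_simps)
    \<comment> \<open>Both terms are nonnegative, so the modulus of their difference is at most the
      sum of their bounds.\<close>
    show ?thesis
      using 1 2 3 unfolding 4 by (simp only: mult.assoc)
  qed
  then have "\<bar>kohn_laplacian (cutoff R) x\<bar> \<le> (\<Sum>i\<in>(UNIV :: 'n set). 888 / R\<^sup>2)"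
    unfolding kohn_laplacian_cutoff M_def[symmetric] by (intro order_trans[OF sum_abs sum_mono])
  then show ?thesis by (simp add: mult.commute)
qed

section \<open>Limit arguments in a single weak equation\<close>

text \<open>A time-independent cutoff removes the \<open>time_deriv\<close> term, so the Laplacian
  term controls the integral of \<open>\<bar>g\<bar> powr r\<close> against the cutoff. As that
  power is integrable, dominated convergence lets the cutoff tend to 1.\<close>

lemma weak_equation_imp_AE_zero:
  fixes f g :: "'n::finite heis \<times> real \<Rightarrow> real"
  assumes eq: "weak_equation T r m f0 f g" and "T > 0" and g: "in_Lp r (Omega T) g"
    and f0: "AE x in lebesgue. 0 \<le> f0 x"
    and lim: "(\<lambda>k. LINT (x, t)|lebesgue_on (Omega T).
        m t * f (x, t) * kohn_laplacian (cutoff (real (Suc k))) x) \<longlonglongrightarrow> 0"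
  shows "AE z in lebesgue_on (Omega T). g z = 0"
proof -
  let ?\<mu> = "lebesgue_on (Omega T) :: ('n heis \<times> real) measure"
  define L where "L k = (LINT (x, t)|?\<mu>. m t * f (x, t) * kohn_laplacian (cutoff (real (Suc k))) x)" for k
  define I where "I k = (LINT z|?\<mu>. \<bar>g z\<bar> powr r * cutoff (real (Suc k)) (fst z))" for k
  have weak: "integrable ?\<mu> (\<lambda>z. \<bar>g z\<bar> powr r * cutoff (real (Suc k)) (fst z)) \<and> \<bar>I k\<bar> \<le> \<bar>L k\<bar>" for k
  proof -
    let ?c = "cutoff (real (Suc k))"
    have "test_function T (\<lambda>z. ?c (fst z))" using \<open>T > 0\<close> by (intro test_function_cutoff) auto
    note w = eq[unfolded weak_equation_def, rule_format, OF this]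
    have "(LINT z|?\<mu>. f z * time_deriv T (\<lambda>z. ?c (fst z)) z) = (LINT z|?\<mu>. 0)"
      by (rule Bochner_Integration.integral_cong)
        (use \<open>T > 0\<close> in \<open>auto simp: Omega_def space_restrict_space time_deriv_const\<close>)
    then have "I k + (LINT x|lebesgue. f0 x * ?c x) = - L k"
      using w by (simp add: I_def L_def)
    \<comment> \<open>With both summands on the left nonnegative, each is at most
      \<open>- L k\<close>.\<close>
    moreover have "0 \<le> (LINT x|lebesgue. f0 x * ?c x)"
      using f0 by (intro integral_nonneg_AE) (auto simp: cutoff_nonneg)
    moreover have "0 \<le> I k" unfolding I_def by (intro Bochner_Integration.integral_nonneg) (simp add: cutoff_nonneg)
    ultimately show ?thesis using w by simp
  qed
  have gi: "integrable ?\<mu> (\<lambda>z. \<bar>g z\<bar> powr r)" using g by (simp add: in_Lp_def)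
  have c1: "(\<lambda>k. cutoff (real (Suc k)) x) \<longlonglongrightarrow> 1" for x :: "'n heis"
  proof -
    have "(\<lambda>k. (max 0 (1 - koranyi x * inverse (real (Suc k)) ^ 4)) ^ 3) \<longlonglongrightarrow> (max 0 (1 - koranyi x * 0 ^ 4)) ^ 3"
      by (intro tendsto_intros LIMSEQ_inverse_real_of_nat)
    then show ?thesis by (simp add: cutoff_def divide_inverse power_inverse)
  qed
  have "I \<longlonglongrightarrow> (LINT z|?\<mu>. \<bar>g z\<bar> powr r)"
    unfolding I_def
  proof (rule integral_dominated_convergence[where w = "\<lambda>z. \<bar>g z\<bar> powr r"])
    show "AE z in ?\<mu>. (\<lambda>k. \<bar>g z\<bar> powr r * cutoff (real (Suc k)) (fst z)) \<longlonglongrightarrow> \<bar>g z\<bar> powr r"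
      using tendsto_mult_left[OF c1] by (intro AE_I2) (metis mult.right_neutral)
    show "AE z in ?\<mu>. norm (\<bar>g z\<bar> powr r * cutoff (real (Suc k)) (fst z)) \<le> \<bar>g z\<bar> powr r" for k
      by (intro AE_I2) (simp add: abs_mult cutoff_nonneg cutoff_le_1 mult_left_le)
  qed (use gi weak in auto)
  moreover have "I \<longlonglongrightarrow> 0"
    using lim weak unfolding L_def[symmetric] by (intro tendsto_0_le[of L _ I 1]) auto
  ultimately have "(LINT z|?\<mu>. \<bar>g z\<bar> powr r) = 0" by (rule LIMSEQ_unique)
  then have "AE z in ?\<mu>. \<bar>g z\<bar> powr r = 0"
    using integral_nonneg_eq_0_iff_AE[OF gi] by simp
  then show ?thesis by simp
qed

text \<open>Applied with \<open>l\<close> a negative power of the radius, in place of Hoelder's inequality.\<close>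

lemma le_add_powr:
  fixes l s y :: real
  assumes "l > 0" "s \<ge> 1" "y \<ge> 0"
  shows "y \<le> l + l powr (1 - s) * y powr s"
proof (cases "y \<le> l")
  case False
  \<comment> \<open>Above the level \<open>l\<close> the power with nonpositive exponent
    \<open>1 - s\<close> is largest at \<open>l\<close>.\<close>
  then have "y powr (1 - s) \<le> l powr (1 - s)" using assms by (intro powr_mono2') auto
  then have "y powr (1 - s) * y powr s \<le> l powr (1 - s) * y powr s" by (rule mult_right_mono) simp
  moreover have "y powr (1 - s) * y powr s = y" using assms False by (simp flip: powr_add)
  ultimately show ?thesis using assms by simp
qed (use assms in \<open>simp add: add_increasing2\<close>)

lemma kohn_laplacian_term_tendsto_0:
  fixes f :: "'n::finite heis \<times> real \<Rightarrow> real"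
  assumes eq: "weak_equation T r m f0 f g" and "T > 0" and f: "in_Lp s (Omega T) f" and "s > 1"
    and Q: "(2 * real CARD('n) + 2) * (s - 1) < 2 * s"
    and m: "\<And>t. 0 < t \<Longrightarrow> t < T \<Longrightarrow> \<bar>m t\<bar> \<le> B"
  shows "(\<lambda>k. LINT (x, t)|lebesgue_on (Omega T).
        m t * f (x, t) * kohn_laplacian (cutoff (real (Suc k))) x) \<longlonglongrightarrow> 0"
proof -
  let ?\<mu> = "lebesgue_on (Omega T) :: ('n heis \<times> real) measure"
  define Q where "Q = 2 * real CARD('n) + 2"
  \<comment> \<open>A rearrangement of the hypothesis on \<open>s\<close>; it makes the interval for
    \<open>\<mu>\<close> nonempty.\<close>
  have "Q - 2 < 2 / (s - 1)" using Q \<open>s > 1\<close> by (simp add: Q_def field_simps)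
  \<comment> \<open>splitting \<open>\<bar>f\<bar>\<close> at the level \<open>l = R powr - \<mu>\<close> makes both resulting powers of \<open>R\<close> negative\<close>
  then obtain \<mu> where \<mu>: "Q - 2 < \<mu>" "\<mu> < 2 / (s - 1)" using dense by blast
  define J where "J = (LINT z|?\<mu>. \<bar>f z\<bar> powr s)"
  \<comment> \<open>\<open>\<bar>B\<bar>\<close> makes \<open>K\<close> nonnegative outright;
    \<open>V\<close> is the volume of the box of radius 1 times \<open>T\<close>.\<close>
  define K where "K = \<bar>B\<bar> * (888 * real CARD('n))"
  define V :: real where "V = 2 ^ (2 * CARD('n) + 1) * T"
  have K: "0 \<le> K" by (simp add: K_def)
  have fi: "integrable ?\<mu> (\<lambda>z. \<bar>f z\<bar> powr s)" using f by (simp add: in_Lp_def)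
  have Om: "Omega T \<in> sets lebesgue"
    by (rule sets_completionI_sets) (auto simp: Omega_def intro!: borel_open open_Times)
  have bound: "\<bar>LINT (x, t)|?\<mu>. m t * f (x, t) * kohn_laplacian (cutoff R) x\<bar>
      \<le> K * V * R powr (Q - 2 - \<mu>) + K * J * R powr (\<mu> * (s - 1) - 2)" if "R > 0" for R
  proof -
    define l where "l = R powr (- \<mu>)"
    have "l > 0" using that by (simp add: l_def)
    \<comment> \<open>The closed time interval makes \<open>S\<close> a single \<open>cbox\<close>
      with known content; the open strip returns through \<open>S \<inter> Omega T\<close>.\<close>
    define S :: "('n heis \<times> real) set" where "S = heis_box R \<times> {0..T}"
    have S_cbox: "S = cbox (((\<chi> i. - R), (\<chi> i. - R), - R\<^sup>2), 0) (((\<chi> i. R), (\<chi> i. R), R\<^sup>2), T)"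
      unfolding S_def heis_box_def by (simp only: cbox_Pair_eq box_real)
    then have S: "S \<in> lmeasurable" by auto
    have SV: "measure lebesgue S = V * R powr Q"
      using content_heis_box[OF that, where 'n = 'n] \<open>T > 0\<close>
      unfolding S_def V_def Q_def heis_box_def box_real(2)[symmetric] cbox_Pair_eq[symmetric]
      by (simp only: measure_completion lmeasurable_cbox sets_lborel borel_closed closed_cbox content_Pair) simp
    have SO: "S \<inter> Omega T \<in> lmeasurable" using S Om by (rule fmeasurable_Int_fmeasurable)
    have mS: "emeasure ?\<mu> (S \<inter> Omega T) = emeasure lebesgue (S \<inter> Omega T)"
      using Om by (intro emeasure_restrict_space) auto
    have iS: "integrable ?\<mu> (indicator (S \<inter> Omega T) :: _ \<Rightarrow> real)"
      using SO mS by (intro integrable_real_indicator) (auto simp: sets_restrict_space fmeasurable_def)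
    have "(LINT z|?\<mu>. indicator (S \<inter> Omega T) z :: real) = measure lebesgue (S \<inter> Omega T)"
      using mS by (simp add: measure_def space_restrict_space)
    also have "\<dots> \<le> measure lebesgue S" using S SO by (intro measure_mono_fmeasurable) auto
    finally have IS: "(LINT z|?\<mu>. indicator (S \<inter> Omega T) z :: real) \<le> V * R powr Q"
      by (simp add: SV)
    let ?F = "\<lambda>(x, t). m t * f (x, t) * kohn_laplacian (cutoff R) x"
    \<comment> \<open>Only the constant \<open>l\<close> has to be restricted to the box to become
      integrable; the power of \<open>f\<close> is integrable on the whole strip.\<close>
    let ?G = "\<lambda>z. K / R\<^sup>2 * (l * indicator (S \<inter> Omega T) z + l powr (1 - s) * \<bar>f z\<bar> powr s)"
    have "test_function T (\<lambda>z. cutoff R (fst z) :: real)"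
      using \<open>T > 0\<close> that by (rule test_function_cutoff)
    from eq[unfolded weak_equation_def, rule_format, OF this]
    have Fi: "integrable ?\<mu> ?F" by simp
    have Gi: "integrable ?\<mu> ?G" by (intro integrable_mult_right Bochner_Integration.integrable_add iS fi)
    have FG: "norm (?F z) \<le> ?G z" if z: "z \<in> space ?\<mu>" for z
    proof -
      obtain x t where zx: "z = (x, t)" by (cases z)
      have t: "0 < t" "t < T" using z by (auto simp: zx Omega_def space_restrict_space)
      show ?thesis
      proof (cases "koranyi x < R ^ 4")
        case False
        then show ?thesis using \<open>R > 0\<close> K \<open>l > 0\<close> by (simp add: zx kohn_laplacian_cutoff_eq_0)
      next
        case True
        then have "z \<in> S \<inter> Omega T"
          using koranyi_less_heis_box[OF True \<open>R > 0\<close>] t by (simp add: zx S_def Omega_def)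
        moreover have "\<bar>m t\<bar> * \<bar>kohn_laplacian (cutoff R) x\<bar> \<le> \<bar>B\<bar> * (888 * real CARD('n) / R\<^sup>2)"
          using m[OF t] abs_kohn_laplacian_cutoff_le[OF \<open>R > 0\<close>, of x] by (intro mult_mono) auto
        then have "\<bar>m t\<bar> * \<bar>kohn_laplacian (cutoff R) x\<bar> * \<bar>f z\<bar> \<le> K / R\<^sup>2 * (l + l powr (1 - s) * \<bar>f z\<bar> powr s)"
          using le_add_powr[of l s "\<bar>f z\<bar>"] \<open>l > 0\<close> \<open>s > 1\<close> K by (intro mult_mono) (auto simp: K_def)
        ultimately show ?thesis by (simp add: zx abs_mult mult_ac)
      qed
    qed
    have "\<bar>integral\<^sup>L ?\<mu> ?F\<bar> \<le> integral\<^sup>L ?\<mu> ?G"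
      using Bochner_Integration.integral_norm_bound_integral[OF Fi Gi FG] by simp
    also have "\<dots> = K / R\<^sup>2 * (l * (LINT z|?\<mu>. indicator (S \<inter> Omega T) z) + l powr (1 - s) * J)"
      unfolding J_def by (simp only: integral_mult_right_zero
          Bochner_Integration.integral_add[OF integrable_mult_right[OF iS] integrable_mult_right[OF fi]])
    also have "\<dots> \<le> K / R\<^sup>2 * (l * (V * R powr Q) + l powr (1 - s) * J)"
      using IS K \<open>l > 0\<close> by (intro mult_left_mono add_mono) auto
    \<comment> \<open>Powers of \<open>R\<close> are collected after inserting
      \<open>l = R powr (- \<mu>)\<close>, so \<open>l powr (1 - s)\<close> contributes the exponent
      \<open>\<mu> * (s - 1)\<close>.\<close>
    also have "\<dots> = K * V * R powr (Q - 2 - \<mu>) + K * J * R powr (\<mu> * (s - 1) - 2)"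
    proof -
      have "R powr (Q - 2 - \<mu>) = R powr (Q + - \<mu> - 2)" by (simp add: algebra_simps)
      also have "\<dots> = R powr Q * R powr (- \<mu>) / R powr 2" by (simp only: powr_diff powr_add)
      finally have "R powr (Q - 2 - \<mu>) = R powr Q * l / R\<^sup>2"
        using that by (simp add: l_def)
      moreover have "\<mu> * (s - 1) - 2 = - \<mu> * (1 - s) - 2" by (simp add: algebra_simps)
      then have "R powr (\<mu> * (s - 1) - 2) = R powr (- \<mu> * (1 - s)) / R powr 2"
        by (simp only: powr_diff)
      then have "R powr (\<mu> * (s - 1) - 2) = l powr (1 - s) / R\<^sup>2"
        using that by (simp add: l_def powr_powr)
      ultimately show ?thesis by (simp only: distrib_left times_divide_eq_left times_divide_eq_right mult_ac)
    qed
    finally show ?thesis .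
  qed
  have R: "filterlim (\<lambda>k. real (Suc k)) at_top sequentially"
    by (rule filterlim_compose[OF filterlim_real_sequentially filterlim_Suc])
  have e: "Q - 2 - \<mu> < 0" "\<mu> * (s - 1) - 2 < 0"
    using \<mu> \<open>s > 1\<close> by (simp_all add: field_simps)
  have "(\<lambda>k. K * V * real (Suc k) powr (Q - 2 - \<mu>) + K * J * real (Suc k) powr (\<mu> * (s - 1) - 2))
      \<longlonglongrightarrow> K * V * 0 + K * J * 0"
    by (intro tendsto_add tendsto_mult_left tendsto_neg_powr[OF _ R] e)
  then have lim: "(\<lambda>k. K * V * real (Suc k) powr (Q - 2 - \<mu>) + K * J * real (Suc k) powr (\<mu> * (s - 1) - 2))
      \<longlonglongrightarrow> 0"
    by simp
  have "norm (LINT (x, t)|?\<mu>. m t * f (x, t) * kohn_laplacian (cutoff (real (Suc k))) x)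
      \<le> K * V * real (Suc k) powr (Q - 2 - \<mu>) + K * J * real (Suc k) powr (\<mu> * (s - 1) - 2)" for k
    unfolding real_norm_def by (rule bound) simp
  then show ?thesis by (intro Lim_null_comparison[OF always_eventually[OF allI] lim])
qed

section \<open>From one equation to the system\<close>

lemma kohn_laplacian_term_eq_0:
  assumes "AE z in lebesgue_on (Omega T). f z = 0"
  shows "(LINT (x, t)|lebesgue_on (Omega T). m t * f (x, t) * kohn_laplacian c x) = 0"
  by (rule integral_eq_zero_AE) (use assms in \<open>auto elim: eventually_mono\<close>)

text \<open>The exponent condition concerns the integrability of \<open>f\<close> and gives
  \<open>g = 0\<close> through the first equation. The Laplacian term of the second contains
  \<open>g\<close>, so it is then 0 and \<open>f = 0\<close> follows without another
  estimate.\<close>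

lemma weak_system_trivial:
  fixes f g :: "'n::finite heis \<times> real \<Rightarrow> real"
  assumes "weak_equation T r m f0 f g" "weak_equation T s k g0 g f" and "T > 0" and "s > 1"
    and "in_Lp s (Omega T) f" "in_Lp r (Omega T) g"
    and "AE x in lebesgue. 0 \<le> f0 x" "AE x in lebesgue. 0 \<le> g0 x"
    and "(2 * real CARD('n) + 2) * (s - 1) < 2 * s"
    and "\<And>t. 0 < t \<Longrightarrow> t < T \<Longrightarrow> \<bar>m t\<bar> \<le> B"
  shows "AE z in lebesgue_on (Omega T). f z = 0 \<and> g z = 0"
proof -
  have g: "AE z in lebesgue_on (Omega T). g z = 0"
    using assms by (intro weak_equation_imp_AE_zero[OF assms(1)] kohn_laplacian_term_tendsto_0[OF assms(1)]) auto
  have "AE z in lebesgue_on (Omega T). f z = 0"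
    using assms by (intro weak_equation_imp_AE_zero[OF assms(2)]) (simp_all add: kohn_laplacian_term_eq_0[OF g])
  with g show ?thesis by auto
qed

section \<open>Bounds on the coefficients, the exponent condition and the conclusion\<close>

lemma M_at_bounded:
  assumes "bounded (M ` ({0..} \<times> {0..} \<times> {0..} \<times> {0..} \<times> {0..}))"
  obtains B where "\<And>t. t > 0 \<Longrightarrow> \<bar>M_at M u \<omega> t\<bar> \<le> B"
proof -
  obtain B where "\<forall>z\<in>M ` ({0..} \<times> {0..} \<times> {0..} \<times> {0..} \<times> {0..}). norm z \<le> B"
    using assms by (auto simp: bounded_iff)
  \<comment> \<open>The energies are integrals of squares, hence nonnegative (0 if the integral does
    not exist), so the arguments of \<open>M\<close> stay where it is bounded.\<close>
  then have "\<bar>M_at M u \<omega> t\<bar> \<le> B" if "t > 0" for t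
    using that by (auto simp: M_at_def hgrad_energy_def kohn_energy_def)
  then show ?thesis by (rule that)
qed

text \<open>The denominator collapses to \<open>(p * q - 1) / (2 * p * q)\<close>, and dropping
  \<open>\<beta>\<close> and \<open>\<gamma> / q\<close> can only raise the numerator, to
  \<open>(p + 1) / (p * q)\<close>.\<close>

lemma exponent_less:
  fixes Q p q \<beta> \<gamma> :: real
  assumes "p > 1" "q > 1" "0 \<le> \<beta>" "0 \<le> \<gamma>"
    and "Q < (1 / q - \<beta> - \<gamma> / q + 1 / (p * q)) / (1 / (2 * q * (p / (p - 1))) + 1 / (2 * (q / (q - 1))))"
  shows "Q * (p * q - 1) < 2 * (p + 1)"
proof -
  have pq: "p * q > 1" using assms less_1_mult by blast
  have D: "1 / (2 * q * (p / (p - 1))) + 1 / (2 * (q / (q - 1))) = (p * q - 1) / (2 * p * q)"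
    using assms(1,2) by (simp add: field_simps)
  have "(p * q - 1) / (2 * p * q) > 0" using assms(1,2) pq by simp
  with assms(5)[unfolded D] have "Q * ((p * q - 1) / (2 * p * q)) < 1 / q - \<beta> - \<gamma> / q + 1 / (p * q)"
    by (simp only: pos_less_divide_eq)
  also have "\<dots> \<le> 1 / q + 1 / (p * q)"
    using assms(3) divide_nonneg_pos[OF assms(4), of q] assms(2) by linarith
  also have "\<dots> = 2 * (p + 1) / (2 * p * q)" using assms(1,2) by (simp add: field_simps)
  finally have "Q * (p * q - 1) / (2 * p * q) < 2 * (p + 1) / (2 * p * q)" by simp
  moreover have "2 * p * q > 0" using assms(1,2) by simp
  ultimately show ?thesis by (simp only: divide_less_cancel if_True simp_thms not_less_iff_gr_or_eq)
qed

text \<open>The smaller exponent qualifies: its excess over 1, times \<open>p + 1\<close>, is at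
  most \<open>p * q - 1\<close>. Cancelling \<open>p + 1\<close> bounds \<open>Q\<close> times that
  excess by 2, which is stronger than required.\<close>

lemma exponent_cases:
  fixes Q p q :: real
  assumes "p > 1" "q > 1" "Q \<ge> 0" "Q * (p * q - 1) < 2 * (p + 1)"
  shows "Q * (p - 1) < 2 * p \<or> Q * (q - 1) < 2 * q"
proof (cases "p \<le> q")
  case True
  have "(p - 1) * (p + 1) \<le> p * q - 1"
    using mult_left_mono[OF True, of p] assms by (simp add: algebra_simps)
  from mult_left_mono[OF this, of Q] have "Q * (p - 1) * (p + 1) < 2 * (p + 1)"
    using assms by (simp add: mult.assoc)
  then have "Q * (p - 1) < 2" by (rule mult_right_less_imp_less) (use assms in simp)
  then show ?thesis using assms by simp
next
  case False
  have "(q - 1) * (p + 1) \<le> p * q - 1" using False by (simp add: algebra_simps)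
  from mult_left_mono[OF this, of Q] have "Q * (q - 1) * (p + 1) < 2 * (p + 1)"
    using assms by (simp add: mult.assoc)
  then have "Q * (q - 1) < 2" by (rule mult_right_less_imp_less) (use assms in simp)
  then show ?thesis using assms by simp
qed

theorem theorem3p4:
  fixes T p q p' q' \<beta>1 \<beta>2 C1 C2 Q A1 A2 :: real
    and M1 M2 :: "real \<times> real \<times> real \<times> real \<times> real \<Rightarrow> real"
  assumes "Q = 2 * real CARD('n::finite) + 2"
    and "T > 0" and "p > 1" and "q > 1"
    and "\<beta>1 \<in> {0..<1}" and "\<beta>2 \<in> {0..<1}"
    and "bounded (M1 ` ({0..} \<times> {0..} \<times> {0..} \<times> {0..} \<times> {0..}))"
    and "bounded (M2 ` ({0..} \<times> {0..} \<times> {0..} \<times> {0..} \<times> {0..}))"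
    and "\<And>t a b c d. \<lbrakk>t > 0; a \<ge> 0; b \<ge> 0; c \<ge> 0; d \<ge> 0\<rbrakk> \<Longrightarrow>
           0 < M1 (t, a, b, c, d) \<and> M1 (t, a, b, c, d) \<le> C1 * t powr \<beta>1"
    and "\<And>t a b c d. \<lbrakk>t > 0; a \<ge> 0; b \<ge> 0; c \<ge> 0; d \<ge> 0\<rbrakk> \<Longrightarrow>
           0 < M2 (t, a, b, c, d) \<and> M2 (t, a, b, c, d) \<le> C2 * t powr \<beta>2"
    and "p' = p / (p - 1)" and "q' = q / (q - 1)"
    and "A1 = (1 / q - \<beta>1 - \<beta>2 / q + 1 / (p * q)) / (1 / (2 * q * p') + 1 / (2 * q'))"
    and "A2 = (1 / p - \<beta>2 - \<beta>1 / p + 1 / (p * q)) / (1 / (2 * q' * p) + 1 / (2 * p'))"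
    and "Q < max A1 A2"
  shows "\<not> (\<exists>(u0 :: 'n heis \<Rightarrow> real) (\<omega>0 :: 'n heis \<Rightarrow> real)
              (u :: 'n heis \<times> real \<Rightarrow> real) (\<omega> :: 'n heis \<times> real \<Rightarrow> real).
            weak_solution T p q M1 M2 u0 \<omega>0 u \<omega> \<and> nontrivial T u \<omega>)"
proof
  assume "\<exists>(u0 :: 'n heis \<Rightarrow> real) (\<omega>0 :: 'n heis \<Rightarrow> real) u \<omega>.
      weak_solution T p q M1 M2 u0 \<omega>0 u \<omega> \<and> nontrivial T u \<omega>"
  then obtain u0 \<omega>0 :: "'n heis \<Rightarrow> real" and u \<omega> where
    ws: "weak_solution T p q M1 M2 u0 \<omega>0 u \<omega>" and "nontrivial T u \<omega>" by blast
  obtain B1 B2 where B: "\<And>t. t > 0 \<Longrightarrow> \<bar>M_at M1 u \<omega> t\<bar> \<le> B1" "\<And>t. t > 0 \<Longrightarrow> \<bar>M_at M2 u \<omega> t\<bar> \<le> B2"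
    using M_at_bounded[OF assms(7)] M_at_bounded[OF assms(8)] by metis
  \<comment> \<open>Interchanging \<open>p\<close> with \<open>q\<close> and \<open>\<beta>1\<close>
    with \<open>\<beta>2\<close> turns \<open>A1\<close> into \<open>A2\<close>, so one lemma serves
    both alternatives of the maximum.\<close>
  have "Q * (p * q - 1) < 2 * (p + 1) \<or> Q * (q * p - 1) < 2 * (q + 1)"
    using exponent_less[of p q \<beta>1 \<beta>2 Q] exponent_less[of q p \<beta>2 \<beta>1 Q] assms(3-6,11-15)
    by (auto simp: less_max_iff_disj mult_ac add.commute)
  then have "Q * (p - 1) < 2 * p \<or> Q * (q - 1) < 2 * q"
    using exponent_cases[of p q Q] exponent_cases[of q p Q] assms(1,3,4) by auto
  then have "AE z in lebesgue_on (Omega T). u z = 0 \<and> \<omega> z = 0"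
  proof
    \<comment> \<open>\<open>p\<close> is the integrability exponent of \<open>\<omega>\<close>, so
      the argument starts from the equation whose Laplacian acts on \<open>\<omega>\<close> and
      yields \<open>u = 0\<close> first. In the other case the roles are exchanged.\<close>
    assume "Q * (p - 1) < 2 * p"
    then have "AE z in lebesgue_on (Omega T). \<omega> z = 0 \<and> u z = 0"
      using ws assms(1-4) B(2)
      by (intro weak_system_trivial[where r = q and s = p and B = B2]) (auto simp: weak_solution_def)
    then show ?thesis by (auto elim: eventually_mono)
  next
    assume "Q * (q - 1) < 2 * q"
    then show ?thesis
      using ws assms(1-4) B(1)
      by (intro weak_system_trivial[where r = p and s = q and B = B1]) (auto simp: weak_solution_def)
  qed
  with \<open>nontrivial T u \<omega>\<close> show False by (simp add: nontrivial_def)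
qed

end
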